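(* Let $A\in\mathbb{R}^{d\times d}$ be symmetric, let $b\in\mathbb{R}^d$ be nonzero, let $g$ be the grade of $b$ with respect to $A$, and run MINRES on $(A,b)$ with $x_0=0$. Assume that $g$ equals the number of distinct eigenvalues of $A$. If $A\not\succeq 0$, then $T_k\not\succ 0$ for some $1\le k\le g$, and hence the NPC condition $c_{k-1}\gamma_k^{(1)}\ge 0$ holds for some $1\le k\le g$.
   Context: Notation: $\|\cdot\|$ is the Euclidean norm; $M\succ 0$ (resp. $M\succeq0$) means the symmetric matrix $M$ is positive definite (resp. positive semi-definite). The Krylov subspace is $\mathcal{K}_k(A,b)=\mathrm{Span}\{b,Ab,\dots,A^{k-1}b\}$. The grade of $b$ with respect to $A$ is the positive integer $g$ such that $\dim\mathcal{K}_k(A,b)=k$ for $k\le g$ and $=g$ for $k>g$. MINRES (exact arithmetic). Initialize $\beta_1=\|b\|$, $r_0=b$, $v_1=b/\beta_1$, $v_0=x_0=\mathbf{d}_0=\mathbf{d}_{-1}=0$, $c_0=-1$, $s_0=0$, $\phi_0=\tau_0=\beta_1$, $\delta_1^{(1)}=0$. For $k=1,2,\dots,g$: set $\alpha_k=v_k^TAv_k$, $p_k=Av_k-\beta_kv_{k-1}-\alpha_kv_k$, $\beta_{k+1}=\|p_k\|$; $\delta_k^{(2)}=c_{k-1}\delta_k^{(1)}+s_{k-1}\alpha_k$, $\gamma_k^{(1)}=s_{k-1}\delta_k^{(1)}-c_{k-1}\alpha_k$, $\epsilon_{k+1}=s_{k-1}\beta_{k+1}$, $\delta_{k+1}^{(1)}=-c_{k-1}\beta_{k+1}$,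 $\gamma_k^{(2)}=\sqrt{(\gamma_k^{(1)})^2+\beta_{k+1}^2}$. If $\gamma_k^{(2)}\ne0$: $c_k=\gamma_k^{(1)}/\gamma_k^{(2)}$, $s_k=\beta_{k+1}/\gamma_k^{(2)}$, $\tau_k=c_k\phi_{k-1}$, $\phi_k=s_k\phi_{k-1}$, $\mathbf{d}_k=(v_k-\delta_k^{(2)}\mathbf{d}_{k-1}-\epsilon_k\mathbf{d}_{k-2})/\gamma_k^{(2)}$, $x_k=x_{k-1}+\tau_k\mathbf{d}_k$, and, if $\beta_{k+1}\ne0$, $v_{k+1}=p_k/\beta_{k+1}$, $r_k=s_k^2r_{k-1}-\phi_kc_kv_{k+1}$, while if $\beta_{k+1}=0$, $r_k=0$ and the iteration stops. If $\gamma_k^{(2)}=0$: $c_k=0$, $s_k=1$, $\tau_k=0$, $\phi_k=\phi_{k-1}$, $r_k=r_{k-1}$, $x_k=x_{k-1}$ and the iteration stops. (The iterations are not stopped when the NPC condition below holds. The process stops after exactly $g$ iterations, $\beta_{k+1}>0$ for $k<g$, $\beta_{g+1}=0$; $x_k$ minimizes $\|b-Ax\|$ over $\mathcal{K}_k(A,b)$ and $r_k=b-Ax_k$.) $T_k\in\mathbb{R}^{k\times k}$ is the symmetric tridiagonal matrix with diagonal $\alpha_1,\dots,\alpha_k$ and off-diagonals $\beta_2,\dots,\beta_k$; equivalently $T_k=V_k^TAV_k$ with $V_k=[v_1\,\cdots\,v_k]$ having orthonormal columns. NPC condition at iteration $k$: $c_{k-1}\gamma_k^{(1)}\ge0$.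 *)

theory Defs
  imports "HOL-Analysis.Analysis"
begin

definition symmetric_matrix :: "real^'n^'n \<Rightarrow> bool" where
  "symmetric_matrix A \<longleftrightarrow> transpose A = A"

definition pos_semidef :: "real^'n^'n \<Rightarrow> bool" where
  "pos_semidef A \<longleftrightarrow> symmetric_matrix A \<and> (\<forall>x. 0 \<le> x \<bullet> (A *v x))"

definition eigenvalues :: "real^'n^'n \<Rightarrow> real set" where
  "eigenvalues A = {l. \<exists>x. x \<noteq> 0 \<and> A *v x = l *\<^sub>R x}"

(* The order of a matrix that varies with k cannot be a type, so a k x k matrix is a
   function M whose entries M i j are only looked at for i, j in {1..k}. *)
definition pos_def_upto :: "nat \<Rightarrow> (nat \<Rightarrow> nat \<Rightarrow> real) \<Rightarrow> bool" where
  "pos_def_upto k M \<longleftrightarrow>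
     (\<forall>i\<in>{1..k}. \<forall>j\<in>{1..k}. M i j = M j i) \<and>
     (\<forall>y :: nat \<Rightarrow> real. (\<exists>i\<in>{1..k}. y i \<noteq> 0) \<longrightarrow>
        0 < (\<Sum>i=1..k. y i * (\<Sum>j=1..k. M i j * y j)))"

definition krylov :: "real^'n^'n \<Rightarrow> real^'n \<Rightarrow> nat \<Rightarrow> (real^'n) set" where
  "krylov A b k = span ((\<lambda>i. ((\<lambda>x. A *v x) ^^ i) b) ` {..<k})"

definition is_grade :: "real^'n^'n \<Rightarrow> real^'n \<Rightarrow> nat \<Rightarrow> bool" where
  "is_grade A b g \<longleftrightarrow> 0 < g \<and>
     (\<forall>k\<le>g. dim (krylov A b k) = k) \<and> (\<forall>k>g. dim (krylov A b k) = g)"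

(* Well defined for b \<noteq> 0; see is_grade_grade below. *)
definition grade :: "real^'n^'n \<Rightarrow> real^'n \<Rightarrow> nat" where
  "grade A b = (THE g. is_grade A b g)"

(* The data held after iteration k (after the initialization for k = 0).  Components
   ending in _next carry the index k+1, those ending in _prev the index k-1, all others
   the index k; ms_dir is the search direction d_k.  ms_stop says that no further
   iteration is carried out. *)
record ('n::finite) minres_state =
  ms_alpha :: real
  ms_beta_next :: real
  ms_v :: "real^'n"
  ms_v_next :: "real^'n"
  ms_delta1_next :: real
  ms_delta2 :: real
  ms_eps_next :: real
  ms_gamma1 :: real
  ms_gamma2 :: real
  ms_c :: real
  ms_s :: real
  ms_tau :: real
  ms_phi :: real
  ms_dir :: "real^'n"
  ms_dir_prev :: "real^'n"
  ms_x :: "real^'n"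
  ms_r :: "real^'n"
  ms_stop :: bool

(* alpha, delta2, gamma1 and gamma2 have no value of index 0; the zeros stored for them
   are never read.  The value of epsilon_1 is immaterial as it multiplies d_{-1} = 0. *)
definition minres_init :: "real^'n \<Rightarrow> ('n::finite) minres_state" where
  "minres_init b = \<lparr>
     ms_alpha = 0, ms_beta_next = norm b,
     ms_v = 0, ms_v_next = b /\<^sub>R norm b,
     ms_delta1_next = 0, ms_delta2 = 0, ms_eps_next = 0,
     ms_gamma1 = 0, ms_gamma2 = 0,
     ms_c = -1, ms_s = 0, ms_tau = norm b, ms_phi = norm b,
     ms_dir = 0, ms_dir_prev = 0,
     ms_x = 0, ms_r = b, ms_stop = False \<rparr>"

(* One iteration, from the data of index k-1 to those of index k.  Whenever the iteration
   stops, v_{k+1} (and d_k if gamma2 = 0) is not assigned by the algorithm; zero is stored. *)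
definition minres_step ::
    "real^'n^'n \<Rightarrow> ('n::finite) minres_state \<Rightarrow> 'n minres_state" where
  "minres_step A S =
    (let c' = ms_c S; s' = ms_s S; phi' = ms_phi S;
         beta = ms_beta_next S; delta1 = ms_delta1_next S; eps = ms_eps_next S;
         v = ms_v_next S;
         alpha = v \<bullet> (A *v v);
         p = A *v v - beta *\<^sub>R ms_v S - alpha *\<^sub>R v;
         beta_next = norm p;
         delta2 = c' * delta1 + s' * alpha;
         gamma1 = s' * delta1 - c' * alpha;
         eps_next = s' * beta_next;
         delta1_next = - c' * beta_next;
         gamma2 = sqrt (gamma1\<^sup>2 + beta_next\<^sup>2)
     in if gamma2 \<noteq> 0 then
          (let c = gamma1 / gamma2;
               s = beta_next / gamma2;
               tau = c * phi';
               phi = s * phi';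
               dir = (v - delta2 *\<^sub>R ms_dir S - eps *\<^sub>R ms_dir_prev S) /\<^sub>R gamma2;
               x = ms_x S + tau *\<^sub>R dir;
               v_next = (if beta_next \<noteq> 0 then p /\<^sub>R beta_next else 0);
               r = (if beta_next \<noteq> 0 then s\<^sup>2 *\<^sub>R ms_r S - (phi * c) *\<^sub>R v_next else 0)
           in \<lparr> ms_alpha = alpha, ms_beta_next = beta_next, ms_v = v, ms_v_next = v_next,
                ms_delta1_next = delta1_next, ms_delta2 = delta2, ms_eps_next = eps_next,
                ms_gamma1 = gamma1, ms_gamma2 = gamma2,
                ms_c = c, ms_s = s, ms_tau = tau, ms_phi = phi,
                ms_dir = dir, ms_dir_prev = ms_dir S,
                ms_x = x, ms_r = r, ms_stop = (beta_next = 0) \<rparr>)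
        else
          \<lparr> ms_alpha = alpha, ms_beta_next = beta_next, ms_v = v, ms_v_next = 0,
            ms_delta1_next = delta1_next, ms_delta2 = delta2, ms_eps_next = eps_next,
            ms_gamma1 = gamma1, ms_gamma2 = gamma2,
            ms_c = 0, ms_s = 1, ms_tau = 0, ms_phi = phi',
            ms_dir = 0, ms_dir_prev = ms_dir S,
            ms_x = ms_x S, ms_r = ms_r S, ms_stop = True \<rparr>)"

(* None means that the process has stopped before iteration k. *)
primrec minres :: "real^'n^'n \<Rightarrow> real^'n \<Rightarrow> nat \<Rightarrow> (('n::finite) minres_state) option" where
  "minres A b 0 = Some (minres_init b)"
| "minres A b (Suc k) =
     (case minres A b k of
        None \<Rightarrow> None
      | Some S \<Rightarrow> if ms_stop S then None else Some (minres_step A S))"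

(* The following quantities are unspecified, through the None, for iterations that are
   not carried out. *)
definition minres_c :: "real^'n^'n \<Rightarrow> real^'n \<Rightarrow> nat \<Rightarrow> real" where
  "minres_c A b k = ms_c (the (minres A b k))"

definition minres_gamma1 :: "real^'n^'n \<Rightarrow> real^'n \<Rightarrow> nat \<Rightarrow> real" where
  "minres_gamma1 A b k = ms_gamma1 (the (minres A b k))"

definition minres_alpha :: "real^'n^'n \<Rightarrow> real^'n \<Rightarrow> nat \<Rightarrow> real" where
  "minres_alpha A b k = ms_alpha (the (minres A b k))"

(* beta_k is computed in iteration k-1; meant for k \<ge> 1 *)
definition minres_beta :: "real^'n^'n \<Rightarrow> real^'n \<Rightarrow> nat \<Rightarrow> real" where
  "minres_beta A b k = ms_beta_next (the (minres A b (k - 1)))"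

(* The entries of T_k do not depend on k: T_k is the part with i, j in {1..k}. *)
definition minres_T :: "real^'n^'n \<Rightarrow> real^'n \<Rightarrow> nat \<Rightarrow> nat \<Rightarrow> real" where
  "minres_T A b i j =
     (if i = j then minres_alpha A b i
      else if i = Suc j then minres_beta A b i
      else if j = Suc i then minres_beta A b j
      else 0)"

definition minres_npc :: "real^'n^'n \<Rightarrow> real^'n \<Rightarrow> nat \<Rightarrow> bool" where
  "minres_npc A b k \<longleftrightarrow> minres_c A b (k - 1) * minres_gamma1 A b k \<ge> 0"

lemma is_grade_unique:
  assumes "is_grade A b g" "is_grade A b h"
  shows "g = h"
proof (rule linorder_cases[of g h])
  assume "g < h"
  then show ?thesis using assms unfolding is_grade_def by (metis order_refl)
next
  assume "h < g"
  then show ?thesis using assms unfolding is_grade_def by (metis order_refl)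
qed

lemma krylov_Suc:
  fixes A :: "real^'n^'n"
  shows "krylov A b (Suc k) = span (insert (((\<lambda>x. A *v x) ^^ k) b) (krylov A b k))"
proof -
  have "span (insert x (span S)) = span (insert x S)" for x :: "real^'n" and S
    by (simp only: span_insert span_span)
  then show ?thesis unfolding krylov_def lessThan_Suc image_insert by simp
qed

lemma krylov_stagnates:
  fixes A :: "real^'n^'n"
  assumes "((\<lambda>x. A *v x) ^^ k) b \<in> krylov A b k"
  shows "((\<lambda>x. A *v x) ^^ Suc k) b \<in> krylov A b (Suc k)"
proof -
  let ?f = "\<lambda>x. A *v x"
  have "linear ?f" by simp
  have "?f ((?f ^^ k) b) \<in> ?f ` krylov A b k"
    using assms by blast
  also have "\<dots> = span (?f ` ((\<lambda>i. (?f ^^ i) b) ` {..<k}))"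
    unfolding krylov_def by (rule linear_span_image[OF \<open>linear ?f\<close>, symmetric])
  also have "\<dots> \<subseteq> krylov A b (Suc k)"
    unfolding krylov_def
  proof (rule span_mono, safe)
    fix i assume "i < k"
    then show "?f ((?f ^^ i) b) \<in> (\<lambda>i. (?f ^^ i) b) ` {..<Suc k}"
      by (intro image_eqI[of _ _ "Suc i"]) auto
  qed
  finally show ?thesis by simp
qed

lemma is_grade_ex:
  fixes A :: "real^'n^'n"
  assumes "b \<noteq> 0"
  shows "\<exists>g. is_grade A b g"
proof -
  let ?u = "\<lambda>k. ((\<lambda>x. A *v x) ^^ k) b"
  let ?K = "krylov A b"
  have dimS: "dim (?K (Suc k)) = (if ?u k \<in> ?K k then dim (?K k) else Suc (dim (?K k)))" for k
  proof -
    have "span (?K k) = ?K k" by (simp only: krylov_def span_span)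
    then show ?thesis
      unfolding krylov_Suc dim_span dim_insert by (simp only: Suc_eq_plus1)
  qed
  have dim0: "dim (?K 0) = 0" by (simp add: krylov_def)
  have full: "dim (?K k) = k" if "\<forall>i<k. ?u i \<notin> ?K i" for k
    using that by (induction k) (auto simp: dimS dim0)
  have ex: "\<exists>k. ?u k \<in> ?K k"
  proof (rule ccontr)
    assume "\<nexists>k. ?u k \<in> ?K k"
    then have "dim (?K (Suc DIM(real^'n))) = Suc DIM(real^'n)" using full by blast
    moreover have "dim (?K (Suc DIM(real^'n))) \<le> DIM(real^'n)" by (rule dim_subset_UNIV)
    ultimately show False by linarith
  qed
  define g where "g = (LEAST k. ?u k \<in> ?K k)"
  have g: "?u g \<in> ?K g" unfolding g_def by (rule LeastI_ex[OF ex])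
  have less: "?u k \<notin> ?K k" if "k < g" for k
    using that unfolding g_def by (rule not_less_Least)
  have "?u 0 \<notin> ?K 0" using assms by (simp add: krylov_def)
  then have g0: "0 < g" using g by (cases "g = 0") auto
  have le: "dim (?K k) = k" if "k \<le> g" for k
    by (rule full) (use that less in \<open>meson less_le_trans\<close>)
  have gt: "dim (?K k) = g" if "k > g" for k
  proof -
    have "?u n \<in> ?K n \<and> dim (?K n) = g" if "g \<le> n" for n
      using that
    proof (induction n rule: dec_induct)
      case base
      show ?case using g le[OF order_refl] by (rule conjI)
    next
      case (step n)
      then have un: "?u n \<in> ?K n" and "dim (?K n) = g" by blast+
      then have "dim (?K (Suc n)) = g" using dimS[of n] by (simp only: if_True)
      with krylov_stagnates[OF un] show ?case by (rule conjI)
    qed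
    then show ?thesis using that by (meson less_imp_le)
  qed
  show ?thesis unfolding is_grade_def using g0 le gt by (intro exI[of _ g] conjI allI impI)
qed

lemma is_grade_grade: "b \<noteq> 0 \<Longrightarrow> is_grade A b (grade A b)"
  unfolding grade_def by (rule theI', rule ex_ex1I) (erule is_grade_ex, erule (1) is_grade_unique)

end

theory Submission
  imports Defs
begin

text \<open>
Let \<open>\<lambda> < 0\<close> be an eigenvalue of \<open>A\<close>; one exists because \<open>A\<close> is not positive semi-definite
(\<open>rayleigh_minimiser\<close>). The Krylov space \<open>K\<close> of dimension \<open>g\<close> is invariant under \<open>A\<close>, and an
eigenvector in \<open>K\<close> is never orthogonal to \<open>b\<close>, so each eigenvalue has at most a one-dimensional
eigenspace in \<open>K\<close>. Diagonalising \<open>A\<close> on \<open>K\<close> therefore produces \<open>g\<close> distinct eigenvalues. As \<open>A\<close>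
has only \<open>g\<close> eigenvalues, \<open>\<lambda>\<close> is one of them (\<open>eigenvector_in_krylov_grade\<close>): \<open>K\<close> contains a
vector \<open>u\<close> with \<open>u \<bullet> A u < 0\<close>.

MINRES builds the Lanczos vectors \<open>v\<^sub>1, \<dots>, v\<^sub>g\<close>. They are orthonormal
(\<open>lanczos_orthonormal\<close>) and their span contains \<open>K\<close> (\<open>krylov_subset_span_lanczos\<close>), while the
entries of \<open>T\<^sub>g\<close> are \<open>v\<^sub>i \<bullet> A v\<^sub>j\<close> (\<open>minres_T_eq_compression\<close>). Hence the coordinates of \<open>u\<close>
witness that \<open>T\<^sub>g\<close> is not positive definite; so \<open>k = g\<close> works for the first claim.

For the second claim, the Givens rotations of MINRES carry the \<open>LDL\<^sup>T\<close> pivots of the tridiagonal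
matrix in disguise: as long as no \<open>c\<^sub>k\<^sub>-\<^sub>1\<close> vanishes, the pivots are
\<open>d\<^sub>k = - \<gamma>\<^sub>k\<^sup>(\<^sup>1\<^sup>) / c\<^sub>k\<^sub>-\<^sub>1\<close> (\<open>minres_pivot_recurrence\<close>). If the NPC condition failed for all
\<open>k \<le> g\<close>, then all \<open>d\<^sub>k\<close> would be positive, and \<open>T\<^sub>g\<close> would be positive definite
(\<open>pos_def_upto_minres_T\<close>).
\<close>

section \<open>Eigenvectors of a symmetric matrix in invariant subspaces\<close>

lemma symmetric_inner:
  fixes A :: "real^'n^'n"
  assumes "symmetric_matrix A"
  shows "x \<bullet> (A *v y) = (A *v x) \<bullet> y"
  using assms dot_lmul_matrix[of x A y] unfolding symmetric_matrix_def
  by (metis transpose_matrix_vector)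

text \<open>A minimiser of the Rayleigh quotient over the unit sphere of \<open>W\<close> is an eigenvector. With
\<open>W = UNIV\<close> this turns a direction of negative curvature into a negative eigenvalue; for smaller
\<open>W\<close> it is used as the existence of an eigenvector in an invariant subspace.\<close>
lemma rayleigh_minimiser:
  fixes A :: "real^'n^'n"
  assumes sym: "symmetric_matrix A"
    and W: "subspace W" "\<And>x. x \<in> W \<Longrightarrow> A *v x \<in> W" "\<exists>x\<in>W. x \<noteq> 0"
  obtains u l where "u \<in> W" "u \<noteq> 0" "A *v u = l *\<^sub>R u"
    "\<And>x. x \<in> W \<Longrightarrow> l * (x \<bullet> x) \<le> x \<bullet> (A *v x)"
proof -
  let ?S = "W \<inter> sphere 0 1"
  obtain x where x: "x \<in> W" "x \<noteq> 0" using W(3) by blast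
  have "x /\<^sub>R norm x \<in> ?S" using x W(1) by (simp add: subspace_scale)
  then have ne: "?S \<noteq> {}" by blast
  have cpt: "compact ?S" by (intro closed_Int_compact closed_subspace W(1) compact_sphere)
  have "continuous_on ?S (\<lambda>x. x \<bullet> (A *v x))"
    by (intro continuous_intros linear_continuous_on) (simp add: linear_conv_bounded_linear[symmetric])
  from continuous_attains_inf[OF cpt ne this]
  obtain u where u: "u \<in> ?S" and min: "\<And>x. x \<in> ?S \<Longrightarrow> u \<bullet> (A *v u) \<le> x \<bullet> (A *v x)" by blast
  define l where "l = u \<bullet> (A *v u)"
  have uu: "u \<bullet> u = 1" using u by (simp add: dot_square_norm)
  have low: "l * (x \<bullet> x) \<le> x \<bullet> (A *v x)" if "x \<in> W" for x
  proof (cases "x = 0")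
    case False
    then have "x /\<^sub>R norm x \<in> ?S" using that W(1) by (simp add: subspace_scale)
    from min[OF this] have "l \<le> (x \<bullet> (A *v x)) / (norm x * norm x)"
      unfolding l_def by (simp add: matrix_vector_mult_scaleR field_simps)
    then show ?thesis using False by (simp add: field_simps dot_square_norm power2_eq_square)
  qed simp
  \<comment> \<open>The residual \<open>z\<close> of the eigenvalue equation vanishes because \<open>u + t z\<close> stays in \<open>W\<close>: the form
    \<open>x \<bullet> A x - l (x \<bullet> x)\<close> is nonnegative along this line and zero at \<open>t = 0\<close>, so its
    linear term \<open>2 t (z \<bullet> z)\<close> must be zero.\<close>
  define z where "z = A *v u - l *\<^sub>R u"
  have zW: "z \<in> W" unfolding z_def using u W by (simp add: subspace_diff subspace_scale)
  define h where "h = z \<bullet> (A *v z) - l * (z \<bullet> z)"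
  have h0: "h \<ge> 0" unfolding h_def using low[OF zW] by simp
  have quad: "0 \<le> t * (2 * (z \<bullet> z) + t * h)" for t
  proof -
    let ?x = "u + t *\<^sub>R z"
    have zz: "z \<bullet> (A *v u) = z \<bullet> z + l * (z \<bullet> u)"
      by (simp add: z_def inner_diff_right)
    have "?x \<in> W" using u zW W(1) by (simp add: subspace_add subspace_scale)
    then have "0 \<le> ?x \<bullet> (A *v ?x) - l * (?x \<bullet> ?x)" using low by simp
    also have "\<dots> = (u \<bullet> (A *v u) - l * (u \<bullet> u))
        + t * (u \<bullet> (A *v z) + z \<bullet> (A *v u) - 2 * l * (z \<bullet> u)) + t * t * h"
      unfolding h_def
      by (simp add: matrix_vector_right_distrib matrix_vector_mult_scaleR inner_add_left
          inner_add_right inner_commute[of u z] algebra_simps)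
    also have "u \<bullet> (A *v z) = z \<bullet> (A *v u)"
      using symmetric_inner[OF sym, of u z] by (simp add: inner_commute)
    also have "u \<bullet> (A *v u) - l * (u \<bullet> u) = 0" using uu by (simp add: l_def)
    finally show ?thesis by (simp add: zz algebra_simps)
  qed
  have "z = 0"
  proof (rule ccontr)
    assume "z \<noteq> 0"
    then have N: "z \<bullet> z > 0" by simp
    \<comment> \<open>At \<open>t = - e\<close> the linear term of the form outweighs the quadratic one, since
      \<open>e h \<le> z \<bullet> z\<close>; the denominator is \<open>h + 1\<close> because \<open>h\<close> may be zero.\<close>
    let ?e = "(z \<bullet> z) / (h + 1)"
    have e: "?e > 0" using N h0 by simp
    have "?e * h \<le> z \<bullet> z" using N h0 by (simp add: field_simps)
    then have "2 * (z \<bullet> z) + (- ?e) * h > 0" using N unfolding mult_minus_left by linarith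
    then have "(- ?e) * (2 * (z \<bullet> z) + (- ?e) * h) < 0" using e by (intro mult_neg_pos) simp_all
    then show False using quad[of "- ?e"] by linarith
  qed
  then have "A *v u = l *\<^sub>R u" by (simp add: z_def)
  moreover have "u \<noteq> 0" using uu by auto
  ultimately show ?thesis using that u low by blast
qed

section \<open>Eigenvectors in the Krylov space of full grade\<close>

lemma mult_image_span:
  fixes A :: "real^'n^'n"
  assumes "\<And>x. x \<in> S \<Longrightarrow> A *v x \<in> span T" and "x \<in> span S"
  shows "A *v x \<in> span T"
proof -
  have "A *v x \<in> span ((\<lambda>x. A *v x) ` S)"
    using assms(2) linear_span_image[of "\<lambda>x. A *v x" S] by simp
  also have "\<dots> \<subseteq> span T" using assms(1) by (intro span_minimal) auto
  finally show ?thesis .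
qed

lemma krylov_grade_invariant:
  fixes A :: "real^'n^'n"
  assumes "is_grade A b g" and "x \<in> krylov A b g"
  shows "A *v x \<in> krylov A b g"
proof -
  have "krylov A b g \<subseteq> krylov A b (Suc g)"
    unfolding krylov_def by (intro span_mono image_mono) auto
  moreover have "dim (krylov A b (Suc g)) \<le> dim (krylov A b g)"
    using assms(1) unfolding is_grade_def by simp
  ultimately have eq: "krylov A b g = krylov A b (Suc g)"
    by (intro subspace_dim_equal) (simp_all add: krylov_def)
  have "A *v x \<in> krylov A b (Suc g)"
    unfolding krylov_def
  proof (rule mult_image_span)
    show "x \<in> span ((\<lambda>i. ((\<lambda>x. A *v x) ^^ i) b) ` {..<g})"
      using assms(2) by (simp add: krylov_def)
  next
    fix y assume "y \<in> (\<lambda>i. ((\<lambda>x. A *v x) ^^ i) b) ` {..<g}"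
    then obtain i where "i < g" "y = ((\<lambda>x. A *v x) ^^ i) b" by blast
    then show "A *v y \<in> span ((\<lambda>i. ((\<lambda>x. A *v x) ^^ i) b) ` {..<Suc g})"
      by (intro span_base image_eqI[of _ _ "Suc i"]) auto
  qed
  with eq show ?thesis by simp
qed

lemma krylov_subset_invariant:
  fixes A :: "real^'n^'n"
  assumes "subspace W" "b \<in> W" "\<And>x. x \<in> W \<Longrightarrow> A *v x \<in> W"
  shows "krylov A b k \<subseteq> W"
proof -
  have "((\<lambda>x. A *v x) ^^ i) b \<in> W" for i by (induction i) (auto simp: assms)
  then show ?thesis unfolding krylov_def by (intro span_minimal assms) auto
qed

text \<open>The orthogonal complement of an eigenvector \<open>z\<close> of a symmetric matrix is invariant. If it
contains \<open>b\<close>, it contains the Krylov space and hence \<open>z\<close> itself. Consequently each eigenvalue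
has at most a one-dimensional eigenspace inside the Krylov space.\<close>
lemma krylov_eigenvector_orthogonal_zero:
  fixes A :: "real^'n^'n"
  assumes sym: "symmetric_matrix A" and z: "z \<in> krylov A b k" "A *v z = l *\<^sub>R z" "z \<bullet> b = 0"
  shows "z = 0"
proof -
  have "krylov A b k \<subseteq> {x. z \<bullet> x = 0}"
    by (rule krylov_subset_invariant)
      (auto simp: subspace_hyperplane z symmetric_inner[OF sym])
  then show ?thesis using z(1) by auto
qed

text \<open>The restriction of \<open>A\<close> to the invariant Krylov space is diagonalisable with simple eigenvalues, so
it has exactly \<open>g\<close> of them. If \<open>A\<close> has no more than \<open>g\<close> eigenvalues, all of them must occur
there. This is the place where the assumption on the grade enters.\<close>
lemma eigenvector_in_krylov_grade:
  fixes A :: "real^'n^'n"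
  assumes sym: "symmetric_matrix A" and gr: "is_grade A b g"
    and cd: "g = card (eigenvalues A)" and l: "l \<in> eigenvalues A"
  shows "\<exists>u \<in> krylov A b g. u \<noteq> 0 \<and> A *v u = l *\<^sub>R u"
proof (rule ccontr)
  assume none: "\<not> ?thesis"
  let ?K = "krylov A b g"
  \<comment> \<open>One eigenvector \<open>w m\<close> is picked for each eigenvalue \<open>m\<close> in \<open>E\<close>. If \<open>l\<close> were missing from
    \<open>E\<close>, these vectors would be too few to span the Krylov space, and its part orthogonal to all
    of them would be nonzero and invariant.\<close>
  define E where "E = {m. \<exists>u\<in>?K. u \<noteq> 0 \<and> A *v u = m *\<^sub>R u}"
  have "\<forall>m\<in>E. \<exists>u. u \<in> ?K \<and> u \<noteq> 0 \<and> A *v u = m *\<^sub>R u" unfolding E_def by blast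
  then obtain w where w: "\<And>m. m \<in> E \<Longrightarrow> w m \<in> ?K \<and> w m \<noteq> 0 \<and> A *v w m = m *\<^sub>R w m"
    by metis
  have fin: "finite (eigenvalues A)"
    using gr cd unfolding is_grade_def by (metis card.infinite less_irrefl)
  have EE: "E \<subset> eigenvalues A"
    using none l unfolding E_def eigenvalues_def by blast
  then have finE: "finite E" using fin by (meson finite_subset psubset_imp_subset)
  have "dim (w ` E) \<le> card (w ` E)" by (rule dim_le_card') (use finE in simp)
  also have "\<dots> \<le> card E" by (rule card_image_le[OF finE])
  also have "\<dots> < g" unfolding cd by (rule psubset_card_mono[OF fin EE])
  also have "g = dim ?K" using gr unfolding is_grade_def by simp
  finally have lt: "dim (w ` E) < dim ?K" .
  have Ksub: "subspace ?K" by (simp add: krylov_def)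
  have spanK: "span ?K = ?K" using Ksub by (simp only: span_eq_iff)
  have spK: "span (w ` E) \<subseteq> ?K" using w by (intro span_minimal Ksub) auto
  have "span (w ` E) \<subset> span ?K"
  proof -
    have "span (w ` E) \<noteq> ?K" using lt by (metis dim_span less_irrefl)
    then show ?thesis using spK by (simp only: spanK psubset_eq not_False_eq_True simp_thms)
  qed
  then obtain x where x: "x \<noteq> 0" "x \<in> span ?K" "\<And>y. y \<in> span (w ` E) \<Longrightarrow> orthogonal x y"
    using orthogonal_to_subspace_exists_gen by metis
  define W where "W = ?K \<inter> {x. \<forall>m\<in>E. w m \<bullet> x = 0}"
  have subW: "subspace W"
    unfolding W_def using Ksub
    by (auto simp: subspace_def inner_add_right inner_scaleR_right)
  have invW: "A *v y \<in> W" if "y \<in> W" for y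
    using that krylov_grade_invariant[OF gr] w
    unfolding W_def by (auto simp: symmetric_inner[OF sym])
  have "w m \<bullet> x = 0" if "m \<in> E" for m
    using x(3)[of "w m"] that by (simp add: orthogonal_def inner_commute span_base)
  then have "x \<in> W" unfolding W_def using x(2) spanK by simp
  with x(1) have "\<exists>x\<in>W. x \<noteq> 0" by blast
  then obtain u m where u: "u \<in> W" "u \<noteq> 0" "A *v u = m *\<^sub>R u"
    using rayleigh_minimiser[OF sym subW invW] by blast
  have mE: "m \<in> E" using u unfolding E_def W_def by blast
  \<comment> \<open>\<open>u\<close> and \<open>w m\<close> are orthogonal eigenvectors for the same eigenvalue; this combination of
    them is orthogonal to \<open>b\<close>, which is impossible in the Krylov space unless it is zero.\<close>
  define z where "z = (w m \<bullet> b) *\<^sub>R u - (u \<bullet> b) *\<^sub>R w m"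
  have "z = 0"
  proof (rule krylov_eigenvector_orthogonal_zero[OF sym])
    show "z \<in> ?K" using u w[OF mE] Ksub unfolding z_def W_def
      by (simp add: subspace_diff subspace_scale)
    show "A *v z = m *\<^sub>R z"
      unfolding z_def using u w[OF mE]
      by (simp add: matrix_vector_mult_diff_distrib matrix_vector_mult_scaleR algebra_simps)
    show "z \<bullet> b = 0" unfolding z_def by (simp add: inner_diff_left)
  qed
  moreover have "u \<bullet> w m = 0" using u mE unfolding W_def by (simp add: inner_commute)
  moreover have "u \<bullet> z = (w m \<bullet> b) * (u \<bullet> u) - (u \<bullet> b) * (u \<bullet> w m)"
    unfolding z_def by (simp add: inner_diff_right)
  ultimately have "(w m \<bullet> b) * (u \<bullet> u) = 0" by simp
  then have "w m \<bullet> b = 0" using u by simp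
  then have "w m = 0" using krylov_eigenvector_orthogonal_zero[OF sym] w[OF mE] by blast
  then show False using w[OF mE] by simp
qed

lemma negative_vector_in_krylov_grade:
  fixes A :: "real^'n^'n"
  assumes sym: "symmetric_matrix A" and gr: "is_grade A b g"
    and cd: "g = card (eigenvalues A)" and neg: "\<not> pos_semidef A"
  obtains u where "u \<in> krylov A b g" "u \<bullet> (A *v u) < 0"
proof -
  obtain x where x: "x \<bullet> (A *v x) < 0"
    using neg sym unfolding pos_semidef_def by (meson not_le)
  then have "x \<noteq> 0" by auto
  then obtain w l where w: "w \<noteq> 0" "A *v w = l *\<^sub>R w"
    and low: "\<And>x. x \<in> UNIV \<Longrightarrow> l * (x \<bullet> x) \<le> x \<bullet> (A *v x)"
    using rayleigh_minimiser[OF sym, of UNIV] by (metis UNIV_I subspace_UNIV)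
  have "l < 0"
  proof (rule ccontr)
    assume "\<not> l < 0"
    then have "0 \<le> l * (x \<bullet> x)" by simp
    then show False using low[of x] x by simp
  qed
  have "l \<in> eigenvalues A" using w unfolding eigenvalues_def by blast
  then obtain u where "u \<in> krylov A b g" "u \<noteq> 0" "A *v u = l *\<^sub>R u"
    using eigenvector_in_krylov_grade[OF sym gr cd] by blast
  then show ?thesis using that[of u] \<open>l < 0\<close> by (simp add: mult_neg_pos)
qed

section \<open>Positive definiteness of compressed and tridiagonal matrices\<close>

text \<open>The numbers \<open>d k\<close> are the pivots of the \<open>LDL\<^sup>T\<close> factorisation: the quadratic form is
\<open>\<Sum>i<n. d i (y i + M i (i+1) / d i * y (i+1))\<^sup>2 + d n (y n)\<^sup>2\<close>.
The induction carries along the lower bound \<open>d k (y k)\<^sup>2\<close> on the leading form of order \<open>k\<close>, which is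
exactly what is needed to absorb the cross term with \<open>y (k+1)\<close>.\<close>
lemma pos_def_upto_tridiagonal:
  assumes sym: "\<And>i j. M i j = M j i"
    and tri: "\<And>i j. Suc i < j \<Longrightarrow> M i j = 0"
    and d1: "d 1 = M 1 1"
    and dSuc: "\<And>k. 1 \<le> k \<Longrightarrow> k < n \<Longrightarrow> d (Suc k) = M (Suc k) (Suc k) - (M k (Suc k))\<^sup>2 / d k"
    and dpos: "\<And>k. 1 \<le> k \<Longrightarrow> k \<le> n \<Longrightarrow> 0 < d k"
    and n: "1 \<le> n"
  shows "pos_def_upto n M"
proof -
  define Q where "Q k y = (\<Sum>i=1..k. y i * (\<Sum>j=1..k. M i j * y j))" for k and y :: "nat \<Rightarrow> real"
  have last: "(\<Sum>i=1..k. f i * M i (Suc k)) = f k * M k (Suc k)" if "1 \<le> k" for k and f :: "nat \<Rightarrow> real"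
  proof -
    have "(\<Sum>i=1..k. f i * M i (Suc k)) = (\<Sum>i\<in>{k}. f i * M i (Suc k))"
      by (rule sum.mono_neutral_right) (use that tri in auto)
    then show ?thesis by simp
  qed
  have QSuc: "Q (Suc k) y = Q k y + 2 * M k (Suc k) * y k * y (Suc k)
      + M (Suc k) (Suc k) * (y (Suc k))\<^sup>2" if "1 \<le> k" for k y
  proof -
    have 1: "(\<Sum>i=1..k. y i * (M i (Suc k) * y (Suc k))) = M k (Suc k) * y k * y (Suc k)"
      using last[OF that, of "\<lambda>i. y i * y (Suc k)"] by (simp add: mult_ac)
    have 2: "(\<Sum>j=1..k. M (Suc k) j * y j) = M k (Suc k) * y k"
      using last[OF that, of y] by (simp add: mult_ac sym[of "Suc k"])
    show ?thesis unfolding Q_def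
      by (simp add: distrib_left sum.distrib 1 2[simplified] del: One_nat_def)
        (use 1 2 in \<open>simp add: algebra_simps power2_eq_square\<close>)
  qed
  have "k \<le> n \<Longrightarrow> (\<forall>y. d k * (y k)\<^sup>2 \<le> Q k y) \<and> (\<forall>y. (\<exists>i\<in>{1..k}. y i \<noteq> 0) \<longrightarrow> 0 < Q k y)"
    if "1 \<le> k" for k
    using that
  proof (induction k rule: dec_induct)
    case base
    have "Q 1 y = d 1 * (y 1)\<^sup>2" for y using d1 by (simp add: Q_def power2_eq_square)
    then show ?case using dpos[of 1] n by simp
  next
    case (step k)
    then have k: "1 \<le> k" "k < n" by auto
    \<comment> \<open>Completing the square in \<open>y k\<close> moves the cross term into the next pivot.\<close>
    have low: "d (Suc k) * (y (Suc k))\<^sup>2 \<le> Q (Suc k) y" for y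
    proof -
      have "d k * (y k)\<^sup>2 \<le> Q k y" using step by simp
      moreover have "0 \<le> d k * (y k + M k (Suc k) / d k * y (Suc k))\<^sup>2"
        using dpos[of k] k by simp
      moreover have "d k * (y k + M k (Suc k) / d k * y (Suc k))\<^sup>2
        = d k * (y k)\<^sup>2 + 2 * M k (Suc k) * y k * y (Suc k)
          + (M k (Suc k))\<^sup>2 / d k * (y (Suc k))\<^sup>2"
        using dpos[of k] k by (simp add: field_simps power2_eq_square)
      ultimately show ?thesis
        unfolding QSuc[OF k(1)] dSuc[OF k] by (simp add: algebra_simps)
    qed
    have "0 < Q (Suc k) y" if ex: "\<exists>i\<in>{1..Suc k}. y i \<noteq> 0" for y
    proof (cases "y (Suc k) = 0")
      case True
      then have "\<exists>i\<in>{1..k}. y i \<noteq> 0" using ex by (metis atLeastAtMost_iff le_Suc_eq)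
      then have "0 < Q k y" using step by simp
      then show ?thesis using True by (simp add: QSuc[OF k(1)])
    next
      case False
      then have "0 < d (Suc k) * (y (Suc k))\<^sup>2" using dpos[of "Suc k"] k by simp
      then show ?thesis using low[of y] by linarith
    qed
    then show ?case using low by blast
  qed
  then show ?thesis using n sym unfolding pos_def_upto_def Q_def by simp
qed

text \<open>The coordinates of \<open>u\<close> in the orthonormal family turn \<open>u \<bullet> A u\<close> into the quadratic form
of \<open>M\<close>.\<close>
lemma not_pos_def_upto_compression:
  fixes A :: "real^'n^'n"
  assumes orth: "\<And>i j. i \<in> {1..n} \<Longrightarrow> j \<in> {1..n} \<Longrightarrow> v i \<bullet> v j = (if i = j then 1 else 0)"
    and M: "\<And>i j. i \<in> {1..n} \<Longrightarrow> j \<in> {1..n} \<Longrightarrow> M i j = v i \<bullet> (A *v v j)"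
    and u: "u \<in> span (v ` {1..n})" "u \<bullet> (A *v u) < 0"
  shows "\<not> pos_def_upto n M"
proof -
  have inj: "inj_on v {1..n}"
    using orth by (metis inj_onI zero_neq_one)
  from u(1) obtain f where "u = (\<Sum>x\<in>v ` {1..n}. f x *\<^sub>R x)"
    by (auto simp: span_finite)
  then have uy: "u = (\<Sum>i=1..n. f (v i) *\<^sub>R v i)" by (simp only: sum.reindex[OF inj] o_def)
  define y where "y i = f (v i)" for i
  have Au: "A *v u = (\<Sum>j=1..n. y j *\<^sub>R (A *v v j))"
    unfolding uy y_def by (simp add: linear_sum[of "\<lambda>x. A *v x"] matrix_vector_mult_scaleR)
  have "u \<bullet> (A *v u) = (\<Sum>i=1..n. y i * (v i \<bullet> (A *v u)))"
    by (subst uy) (simp add: inner_sum_left y_def)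
  also have "\<dots> = (\<Sum>i=1..n. y i * (\<Sum>j=1..n. M i j * y j))"
    unfolding Au by (intro sum.cong) (auto simp: inner_sum_right M mult_ac)
  finally have neg: "(\<Sum>i=1..n. y i * (\<Sum>j=1..n. M i j * y j)) < 0" using u(2) by simp
  then have "\<exists>i\<in>{1..n}. y i \<noteq> 0"
    by (metis (no_types, lifting) less_irrefl mult_zero_left sum.neutral)
  with neg show ?thesis unfolding pos_def_upto_def by (meson less_asym)
qed

section \<open>The Lanczos recurrence inside MINRES\<close>

abbreviation minres_st :: "real^'n^'n \<Rightarrow> real^'n \<Rightarrow> nat \<Rightarrow> ('n::finite) minres_state" where
  "minres_st A b k \<equiv> the (minres A b k)"

text \<open>Reading \<open>v\<^sub>k\<close> from the state of index \<open>k\<close> instead of its predecessor provides the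
convention \<open>v\<^sub>0 = 0\<close>, with which the three-term recurrence starts.\<close>
definition lanczos_v :: "real^'n^'n \<Rightarrow> real^'n \<Rightarrow> nat \<Rightarrow> real^'n" where
  "lanczos_v A b k = ms_v (minres_st A b k)"

text \<open>Under this condition iteration \<open>Suc k\<close> is carried out, possibly as the last one, so the data
of all indices up to \<open>Suc k\<close> are those of the algorithm.\<close>
definition minres_runs :: "real^'n^'n \<Rightarrow> real^'n \<Rightarrow> nat \<Rightarrow> bool" where
  "minres_runs A b k \<longleftrightarrow> (\<exists>S. minres A b k = Some S \<and> \<not> ms_stop S)"

lemma minres_step_simps:
  "ms_alpha (minres_step A S) = ms_v_next S \<bullet> (A *v ms_v_next S)"
  "ms_v (minres_step A S) = ms_v_next S"
  "ms_beta_next (minres_step A S) = norm (A *v ms_v_next S - ms_beta_next S *\<^sub>R ms_v S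
     - ms_alpha (minres_step A S) *\<^sub>R ms_v_next S)"
  "ms_delta1_next (minres_step A S) = - ms_c S * ms_beta_next (minres_step A S)"
  "ms_gamma1 (minres_step A S) =
     ms_s S * ms_delta1_next S - ms_c S * ms_alpha (minres_step A S)"
  unfolding minres_step_def by (simp_all add: Let_def)

lemma minres_step_beta_nonzero:
  assumes "ms_beta_next (minres_step A S) \<noteq> 0"
  shows "\<not> ms_stop (minres_step A S)"
    and "ms_beta_next (minres_step A S) *\<^sub>R ms_v_next (minres_step A S)
      = A *v ms_v_next S - ms_beta_next S *\<^sub>R ms_v S - ms_alpha (minres_step A S) *\<^sub>R ms_v_next S"
  using assms unfolding minres_step_def by (auto simp: Let_def)

text \<open>The common denominator \<open>q\<close> is \<open>\<gamma>\<^sup>(\<^sup>2\<^sup>)\<close>; for the pivots it only matters that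
\<open>c\<close> and \<open>s\<close> are proportional to \<open>\<gamma>\<^sup>(\<^sup>1\<^sup>)\<close> and \<open>\<beta>\<close>.\<close>
lemma minres_step_running:
  assumes "\<not> ms_stop (minres_step A S)"
  shows "ms_beta_next (minres_step A S) > 0"
    and "\<exists>q>0. ms_c (minres_step A S) = ms_gamma1 (minres_step A S) / q \<and>
           ms_s (minres_step A S) = ms_beta_next (minres_step A S) / q"
proof -
  show "ms_beta_next (minres_step A S) > 0"
    using assms unfolding minres_step_def by (auto simp: Let_def split: if_splits)
next
  have "ms_gamma2 (minres_step A S) > 0"
    using assms unfolding minres_step_def
    by (auto simp: Let_def split: if_splits intro!: add_nonneg_pos)
  moreover have "ms_c (minres_step A S) = ms_gamma1 (minres_step A S) / ms_gamma2 (minres_step A S) \<and>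
           ms_s (minres_step A S) = ms_beta_next (minres_step A S) / ms_gamma2 (minres_step A S)"
    using assms unfolding minres_step_def by (auto simp: Let_def split: if_splits)
  ultimately show "\<exists>q>0. ms_c (minres_step A S) = ms_gamma1 (minres_step A S) / q \<and>
           ms_s (minres_step A S) = ms_beta_next (minres_step A S) / q" by blast
qed

lemma minres_runs_0: "minres_runs A b 0"
  by (simp add: minres_runs_def minres_init_def)

lemma minres_st_Suc:
  assumes "minres_runs A b k"
  shows "minres_st A b (Suc k) = minres_step A (minres_st A b k)"
    and "minres_runs A b (Suc k) \<longleftrightarrow> \<not> ms_stop (minres_st A b (Suc k))"
  using assms unfolding minres_runs_def by auto

lemma lanczos_v_0: "lanczos_v A b 0 = 0"
  by (simp add: lanczos_v_def minres_init_def)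

lemma lanczos_v_Suc:
  "minres_runs A b k \<Longrightarrow> lanczos_v A b (Suc k) = ms_v_next (minres_st A b k)"
  by (simp add: lanczos_v_def minres_st_Suc minres_step_simps del: minres.simps)

lemma lanczos_v_1: "lanczos_v A b 1 = b /\<^sub>R norm b"
  using lanczos_v_Suc[OF minres_runs_0] by (simp add: minres_init_def)

lemma minres_alpha_eq:
  "minres_runs A b k \<Longrightarrow>
     minres_alpha A b (Suc k) = lanczos_v A b (Suc k) \<bullet> (A *v lanczos_v A b (Suc k))"
  unfolding lanczos_v_def minres_alpha_def
  by (simp add: minres_st_Suc minres_step_simps del: minres.simps)

text \<open>This holds even if the process ends with iteration \<open>Suc k\<close>, so it can serve to show that
it does not.\<close>
lemma lanczos_beta:
  assumes "minres_runs A b k"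
  shows "minres_beta A b (k + 2) = norm (A *v lanczos_v A b (Suc k)
      - minres_beta A b (Suc k) *\<^sub>R lanczos_v A b k
      - minres_alpha A b (Suc k) *\<^sub>R lanczos_v A b (Suc k))"
  using minres_step_simps(3)[of A "minres_st A b k"]
  unfolding lanczos_v_Suc[OF assms] minres_alpha_def minres_beta_def
  by (simp add: minres_st_Suc[OF assms] lanczos_v_def del: minres.simps)

lemma minres_runs_SucI:
  assumes "minres_runs A b k" and "minres_beta A b (k + 2) \<noteq> 0"
  shows "minres_runs A b (Suc k)"
  using assms minres_step_beta_nonzero(1)[of A "minres_st A b k"]
  by (simp add: minres_st_Suc minres_beta_def del: minres.simps)

lemma lanczos_recurrence:
  assumes "minres_runs A b k" "minres_runs A b (Suc k)"
  shows "A *v lanczos_v A b (Suc k) = minres_beta A b (Suc k) *\<^sub>R lanczos_v A b k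
      + minres_alpha A b (Suc k) *\<^sub>R lanczos_v A b (Suc k)
      + minres_beta A b (k + 2) *\<^sub>R lanczos_v A b (k + 2)"
proof -
  have st: "minres_st A b (Suc k) = minres_step A (minres_st A b k)"
    by (rule minres_st_Suc[OF assms(1)])
  have "\<not> ms_stop (minres_step A (minres_st A b k))"
    using assms(2) minres_st_Suc[OF assms(1)] by simp
  then have pos: "0 < ms_beta_next (minres_step A (minres_st A b k))"
    by (rule minres_step_running)
  have v2: "lanczos_v A b (k + 2) = ms_v_next (minres_st A b (Suc k))"
    using lanczos_v_Suc[OF assms(2)] by simp
  show "A *v lanczos_v A b (Suc k) = minres_beta A b (Suc k) *\<^sub>R lanczos_v A b k
      + minres_alpha A b (Suc k) *\<^sub>R lanczos_v A b (Suc k)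
      + minres_beta A b (k + 2) *\<^sub>R lanczos_v A b (k + 2)"
    using minres_step_beta_nonzero(2)[of A "minres_st A b k"] pos
    unfolding lanczos_v_Suc[OF assms(1)] v2 minres_alpha_def minres_beta_def
    by (simp add: st lanczos_v_def algebra_simps del: minres.simps)
qed

section \<open>Orthonormality of the Lanczos vectors\<close>

text \<open>No breakdown before iteration \<open>g\<close> and orthonormality have to be proved together: orthogonality of
the next vector needs the recurrence, which needs that the process has not stopped.\<close>
lemma lanczos_orthonormal:
  fixes A :: "real^'n^'n"
  assumes sym: "symmetric_matrix A" and b: "b \<noteq> 0" and gr: "is_grade A b g" and "k < g"
  shows "minres_runs A b k"
    and "i \<in> {1..Suc k} \<Longrightarrow> j \<in> {1..Suc k} \<Longrightarrow>
          lanczos_v A b i \<bullet> lanczos_v A b j = (if i = j then 1 else 0)"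
proof -
  let ?v = "lanczos_v A b" and ?\<alpha> = "minres_alpha A b" and ?\<beta> = "minres_beta A b"
  have "k < g \<Longrightarrow> (\<forall>j\<le>k. minres_runs A b j) \<and>
      (\<forall>i\<in>{1..Suc k}. \<forall>j\<in>{1..Suc k}. ?v i \<bullet> ?v j = (if i = j then 1 else 0))" for k
  proof (induction k)
    case 0
    have "?v 1 \<bullet> ?v 1 = 1"
      unfolding lanczos_v_1
      using b by (simp add: dot_square_norm power2_eq_square)
    then show ?case using minres_runs_0 by simp
  next
    case (Suc k)
    then have runs: "\<And>j. j \<le> k \<Longrightarrow> minres_runs A b j"
      and orth: "\<And>i j. i \<in> {1..Suc k} \<Longrightarrow> j \<in> {1..Suc k} \<Longrightarrow> ?v i \<bullet> ?v j = (if i = j then 1 else 0)"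
      by auto
    have orth0: "?v i \<bullet> ?v j = (if i = j then 1 else 0)" if "i \<le> Suc k" "j \<in> {1..Suc k}" for i j
      using that orth by (cases "i = 0") (auto simp: lanczos_v_0)
    have rec: "A *v ?v i = ?\<beta> i *\<^sub>R ?v (i - 1) + ?\<alpha> i *\<^sub>R ?v i + ?\<beta> (Suc i) *\<^sub>R ?v (Suc i)"
      if "i \<in> {1..k}" for i
      using that lanczos_recurrence[of A b "i - 1"] runs[of "i - 1"] runs[of i]
      by (cases i) auto
    define p where "p = A *v ?v (Suc k) - ?\<beta> (Suc k) *\<^sub>R ?v k - ?\<alpha> (Suc k) *\<^sub>R ?v (Suc k)"
    have \<beta>p: "?\<beta> (k + 2) = norm p" unfolding p_def by (rule lanczos_beta[OF runs]) simp
    \<comment> \<open>A zero \<open>p\<close> would make the span of the first \<open>Suc k\<close> vectors invariant, so that the Krylov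
      space could not reach dimension \<open>g\<close>.\<close>
    have "p \<noteq> 0"
    proof
      assume "p = 0"
      let ?S = "?v ` {1..Suc k}"
      have base: "?v i \<in> span ?S" if "i \<le> Suc k" for i
        using that by (cases "i = 0") (auto simp: lanczos_v_0 span_zero intro!: span_base)
      have inv: "A *v ?v i \<in> span ?S" if i: "i \<in> {1..Suc k}" for i
      proof (cases "i = Suc k")
        case True
        have "A *v ?v (Suc k) = ?\<beta> (Suc k) *\<^sub>R ?v k + ?\<alpha> (Suc k) *\<^sub>R ?v (Suc k)"
          using \<open>p = 0\<close> unfolding p_def by (simp add: algebra_simps)
        then show ?thesis unfolding True by (simp only:) (intro span_add span_scale base, auto)
      next
        case False
        with i have "i \<in> {1..k}" by auto
        then show ?thesis unfolding rec[OF \<open>i \<in> {1..k}\<close>]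
          by (intro span_add span_scale base) auto
      qed
      have "b = norm b *\<^sub>R ?v 1"
        using b by (simp only: lanczos_v_1) simp
      then have "b \<in> span ?S" using base[of 1] by (metis le_add1 plus_1_eq_Suc span_scale)
      moreover have "A *v x \<in> span ?S" if "x \<in> span ?S" for x
        by (rule mult_image_span[OF _ that]) (use inv in blast)
      ultimately have "krylov A b g \<subseteq> span ?S"
        by (intro krylov_subset_invariant subspace_span)
      then have "dim (krylov A b g) \<le> dim ?S" by (metis dim_span dim_subset)
      also have "\<dots> \<le> card ?S" by (rule dim_le_card') simp
      also have "\<dots> \<le> Suc k" using card_image_le[of "{1..Suc k}" ?v] by simp
      also have "Suc k < g" by (rule Suc.prems)
      finally show False using gr unfolding is_grade_def by simp
    qed
    then have pos: "?\<beta> (k + 2) > 0" using \<beta>p by simp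
    then have runsS: "minres_runs A b (Suc k)"
      by (intro minres_runs_SucI runs) auto
    have pv: "p = ?\<beta> (k + 2) *\<^sub>R ?v (k + 2)"
      unfolding p_def using lanczos_recurrence[OF runs[OF order_refl] runsS] by simp
    \<comment> \<open>Only the last two vectors need to be subtracted: by symmetry \<open>v i \<bullet> A v\<close>, with \<open>v\<close> the newest
      vector, is \<open>A (v i) \<bullet> v\<close>, and \<open>A (v i)\<close> involves no index beyond \<open>Suc i\<close>.\<close>
    have perp: "?v i \<bullet> p = 0" if i: "i \<in> {1..Suc k}" for i
    proof (cases "i = Suc k")
      case True
      have "?v (Suc k) \<bullet> ?v k = 0" using orth0[of k "Suc k"] by (simp add: inner_commute)
      moreover have "?v (Suc k) \<bullet> ?v (Suc k) = 1" using orth by simp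
      ultimately show ?thesis
        unfolding True p_def
        by (simp add: inner_diff_right minres_alpha_eq[OF runs[OF order_refl]])
    next
      case False
      with i have ik: "i \<in> {1..k}" by auto
      have "?v i \<bullet> (A *v ?v (Suc k)) = (A *v ?v i) \<bullet> ?v (Suc k)" by (rule symmetric_inner[OF sym])
      also have "\<dots> = (if i = k then ?\<beta> (Suc k) else 0)"
        unfolding rec[OF ik] using ik
        by (auto simp: inner_add_left orth0 split: if_splits)
      finally show ?thesis using ik unfolding p_def by (auto simp: inner_diff_right orth0)
    qed
    have "(?\<beta> (k + 2))\<^sup>2 * (?v (k + 2) \<bullet> ?v (k + 2)) = p \<bullet> p"
      by (simp add: pv power2_eq_square)
    also have "\<dots> = (?\<beta> (k + 2))\<^sup>2" by (simp only: \<beta>p dot_square_norm)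
    finally have unit: "?v (Suc (Suc k)) \<bullet> ?v (Suc (Suc k)) = 1" using pos by simp
    have perp': "?v i \<bullet> ?v (Suc (Suc k)) = 0" "?v (Suc (Suc k)) \<bullet> ?v i = 0" if "i \<in> {1..Suc k}" for i
      using perp[OF that] pos by (simp_all add: pv inner_commute)
    have "?v i \<bullet> ?v j = (if i = j then 1 else 0)"
      if "i \<in> {1..Suc (Suc k)}" "j \<in> {1..Suc (Suc k)}" for i j
    proof -
      from that consider "i = Suc (Suc k)" "j = Suc (Suc k)" | "i = Suc (Suc k)" "j \<in> {1..Suc k}"
        | "i \<in> {1..Suc k}" "j = Suc (Suc k)" | "i \<in> {1..Suc k}" "j \<in> {1..Suc k}"
        by (auto simp: le_Suc_eq)
      then show ?thesis using unit perp' orth by cases auto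
    qed
    then show ?case using runs runsS by (metis le_Suc_eq)
  qed
  from this[OF \<open>k < g\<close>]
  show "minres_runs A b k"
    and "i \<in> {1..Suc k} \<Longrightarrow> j \<in> {1..Suc k} \<Longrightarrow> ?v i \<bullet> ?v j = (if i = j then 1 else 0)"
    by auto
qed

text \<open>Below the subdiagonal the entries vanish by the three-term recurrence. Above the diagonal
symmetry is used, since the recurrence for the column \<open>j = g\<close> is not available: the process
stops there.\<close>
lemma minres_T_eq_compression:
  fixes A :: "real^'n^'n"
  assumes sym: "symmetric_matrix A" and b: "b \<noteq> 0" and gr: "is_grade A b g"
    and ij: "i \<in> {1..g}" "j \<in> {1..g}"
  shows "minres_T A b i j = lanczos_v A b i \<bullet> (A *v lanczos_v A b j)"
proof -
  let ?v = "lanczos_v A b"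
  note runs = lanczos_orthonormal(1)[OF sym b gr]
  have orth: "?v i \<bullet> ?v j = (if i = j then 1 else 0)" if "i \<in> {1..g}" "j \<in> {1..g}" for i j
    using that lanczos_orthonormal(2)[OF sym b gr, of "g - 1" i j] by simp
  have lower: "?v i \<bullet> (A *v ?v j) = (if i = Suc j then minres_beta A b i else 0)"
    if ij: "i \<in> {1..g}" "j \<in> {1..g}" "j < i" for i j
  proof -
    obtain l where l: "j = Suc l" using ij(2) by (cases j) auto
    have "?v i \<bullet> ?v l = 0" using ij l orth[of i l] by (cases "l = 0") (auto simp: lanczos_v_0)
    moreover have "l < g" "Suc l < g" using ij l by auto
    ultimately show ?thesis
      using ij orth[of i "Suc l"] orth[of i "Suc (Suc l)"]
        lanczos_recurrence[OF runs runs, of l]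
      by (auto simp: l inner_add_right)
  qed
  consider "i = j" | "j < i" | "i < j" by linarith
  then show ?thesis
  proof cases
    case 1
    have "j - 1 < g" "Suc (j - 1) = j" using ij by auto
    then show ?thesis using 1 minres_alpha_eq[OF runs, of "j - 1"] by (simp add: minres_T_def)
  next
    case 2
    then show ?thesis using lower[OF ij 2] by (simp add: minres_T_def)
  next
    case 3
    have "?v i \<bullet> (A *v ?v j) = ?v j \<bullet> (A *v ?v i)"
      using symmetric_inner[OF sym] by (simp add: inner_commute)
    then show ?thesis using 3 lower[OF ij(2,1) 3] by (simp add: minres_T_def)
  qed
qed

lemma krylov_subset_span_lanczos:
  fixes A :: "real^'n^'n"
  assumes sym: "symmetric_matrix A" and b: "b \<noteq> 0" and gr: "is_grade A b g"
  shows "krylov A b g \<subseteq> span (lanczos_v A b ` {1..g})"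
proof -
  let ?v = "lanczos_v A b"
  note runs = lanczos_orthonormal(1)[OF sym b gr]
  have "i < g \<Longrightarrow> ((\<lambda>x. A *v x) ^^ i) b \<in> span (?v ` {1..Suc i})" for i
  proof (induction i)
    case 0
    have "b = norm b *\<^sub>R ?v 1"
      using b by (simp only: lanczos_v_1) simp
    then have "b \<in> span {?v 1}" by (metis span_base span_scale singletonI)
    then show ?case by simp
  next
    case (Suc i)
    have "A *v ?v j \<in> span (?v ` {1..Suc (Suc i)})" if j: "j \<in> {1..Suc i}" for j
    proof -
      have base: "?v m \<in> span (?v ` {1..Suc (Suc i)})" if "m \<le> Suc (Suc i)" for m
        using that by (cases "m = 0") (auto simp: lanczos_v_0 span_zero intro!: span_base)
      obtain l where l: "j = Suc l" "l \<le> i" using j by (cases j) auto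
      have "A *v ?v (Suc l) = minres_beta A b (Suc l) *\<^sub>R ?v l
          + minres_alpha A b (Suc l) *\<^sub>R ?v (Suc l) + minres_beta A b (l + 2) *\<^sub>R ?v (l + 2)"
        by (rule lanczos_recurrence) (use l Suc.prems in \<open>auto intro!: runs\<close>)
      then show ?thesis unfolding l(1) using l(2) by (simp only:) (intro span_add span_scale base, auto)
    qed
    then have "A *v y \<in> span (?v ` {1..Suc (Suc i)})" if "y \<in> ?v ` {1..Suc i}" for y
      using that by blast
    moreover have "((\<lambda>x. A *v x) ^^ i) b \<in> span (?v ` {1..Suc i})" using Suc by simp
    ultimately have "A *v ((\<lambda>x. A *v x) ^^ i) b \<in> span (?v ` {1..Suc (Suc i)})"
      by (rule mult_image_span)
    then show ?case by simp
  qed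
  then have "((\<lambda>x. A *v x) ^^ i) b \<in> span (?v ` {1..g})" if "i < g" for i
    using that span_mono[of "?v ` {1..Suc i}" "?v ` {1..g}"] by (force simp: image_mono)
  then show ?thesis unfolding krylov_def by (intro span_minimal) auto
qed

section \<open>The NPC condition and the pivots of the tridiagonal matrix\<close>

lemma minres_gamma1_init:
  "minres_c A b 0 = -1" "minres_gamma1 A b 1 = minres_alpha A b 1"
  using minres_step_simps(5)[of A "minres_init b"]
  by (simp_all add: minres_c_def minres_gamma1_def minres_alpha_def minres_init_def
      del: minres.simps(2) add: minres_st_Suc[OF minres_runs_0, simplified])

text \<open>The quantities \<open>d\<^sub>k = - \<gamma>\<^sub>k\<^sup>(\<^sup>1\<^sup>) / c\<^sub>k\<^sub>-\<^sub>1\<close> obey the pivot recurrence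
\<open>d\<^sub>k\<^sub>+\<^sub>1 = \<alpha>\<^sub>k\<^sub>+\<^sub>1 - \<beta>\<^sub>k\<^sub>+\<^sub>1\<^sup>2 / d\<^sub>k\<close>. Indeed
\<open>\<gamma>\<^sub>k\<^sub>+\<^sub>1\<^sup>(\<^sup>1\<^sup>) = - s\<^sub>k c\<^sub>k\<^sub>-\<^sub>1 \<beta>\<^sub>k\<^sub>+\<^sub>1 - c\<^sub>k \<alpha>\<^sub>k\<^sub>+\<^sub>1\<close>, and division by \<open>- c\<^sub>k\<close> leaves the
ratio \<open>s\<^sub>k / c\<^sub>k = \<beta>\<^sub>k\<^sub>+\<^sub>1 / \<gamma>\<^sub>k\<^sup>(\<^sup>1\<^sup>)\<close>.\<close>
lemma minres_pivot_recurrence: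
  assumes "minres_runs A b k" "minres_runs A b (Suc k)"
    and "minres_c A b k \<noteq> 0" "minres_c A b (Suc k) \<noteq> 0"
  shows "- minres_gamma1 A b (k + 2) / minres_c A b (Suc k) =
     minres_alpha A b (k + 2) - (minres_beta A b (k + 2))\<^sup>2 / (- minres_gamma1 A b (Suc k) / minres_c A b k)"
proof -
  let ?S = "minres_st A b k"
  have S1: "minres_st A b (Suc k) = minres_step A ?S"
    by (rule minres_st_Suc[OF assms(1)])
  have S2: "minres_st A b (Suc (Suc k)) = minres_step A (minres_step A ?S)"
    using minres_st_Suc(1)[OF assms(2)] S1 by simp
  have "\<not> ms_stop (minres_step A ?S)"
    using assms(2) minres_st_Suc[OF assms(1)] by simp
  from minres_step_running(2)[OF this] obtain q where q: "q > 0"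
    "minres_c A b (Suc k) = minres_gamma1 A b (Suc k) / q"
    "ms_s (minres_step A ?S) = minres_beta A b (k + 2) / q"
    by (auto simp: minres_c_def minres_gamma1_def minres_beta_def S1 simp del: minres.simps)
  have "minres_gamma1 A b (k + 2) =
      minres_beta A b (k + 2) / q * (- minres_c A b k * minres_beta A b (k + 2))
      - minres_gamma1 A b (Suc k) / q * minres_alpha A b (k + 2)"
    using minres_step_simps(5)[of A "minres_step A ?S"] minres_step_simps(4)[of A ?S] q
    by (simp add: minres_c_def minres_gamma1_def minres_beta_def minres_alpha_def S1 S2
        del: minres.simps minres_step_simps)
  note gamma1 = this
  have "minres_gamma1 A b (Suc k) \<noteq> 0" using assms(4) q by auto
  then show ?thesis unfolding gamma1 q(2) using q(1) assms(3)
    by (simp add: field_simps power2_eq_square)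
qed

text \<open>The pivot \<open>- \<gamma>\<^sub>k\<^sup>(\<^sup>1\<^sup>) / c\<^sub>k\<^sub>-\<^sub>1\<close> has the sign of \<open>- c\<^sub>k\<^sub>-\<^sub>1 \<gamma>\<^sub>k\<^sup>(\<^sup>1\<^sup>)\<close>, so it is
positive exactly when the NPC condition fails at \<open>k\<close>; the failure also makes \<open>c\<^sub>k\<^sub>-\<^sub>1\<close> nonzero,
as the pivot recurrence requires.\<close>
lemma pos_def_upto_minres_T:
  assumes g: "1 \<le> g" and runs: "\<And>k. k < g \<Longrightarrow> minres_runs A b k"
    and npc: "\<And>k. 1 \<le> k \<Longrightarrow> k \<le> g \<Longrightarrow> \<not> minres_npc A b k"
  shows "pos_def_upto g (minres_T A b)"
proof (rule pos_def_upto_tridiagonal[where d = "\<lambda>k. - minres_gamma1 A b k / minres_c A b (k - 1)"])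
  have neg: "minres_c A b (k - 1) * minres_gamma1 A b k < 0" if "1 \<le> k" "k \<le> g" for k
    using npc[OF that] unfolding minres_npc_def by simp
  have c: "minres_c A b k \<noteq> 0" if "k < g" for k
    using neg[of "Suc k"] that by auto
  show "0 < - minres_gamma1 A b k / minres_c A b (k - 1)" if "1 \<le> k" "k \<le> g" for k
    using neg[OF that] by (simp add: zero_less_divide_iff divide_less_0_iff mult_less_0_iff) blast
  show "- minres_gamma1 A b (Suc k) / minres_c A b (Suc k - 1) = minres_T A b (Suc k) (Suc k)
      - (minres_T A b k (Suc k))\<^sup>2 / (- minres_gamma1 A b k / minres_c A b (k - 1))"
    if "1 \<le> k" "k < g" for k
    using that minres_pivot_recurrence[of A b "k - 1"] runs[of k] runs[of "k - 1"] c[of k] c[of "k - 1"]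
    by (simp add: minres_T_def)
  show "- minres_gamma1 A b 1 / minres_c A b (1 - 1) = minres_T A b 1 1"
    by (simp add: minres_T_def minres_gamma1_init minres_gamma1_init[simplified])
qed (use g in \<open>auto simp: minres_T_def\<close>)

theorem theorem2:
  fixes A :: "real^'n^'n" and b :: "real^'n" and g :: nat
  assumes "symmetric_matrix A"
    and "b \<noteq> 0"
    and "g = grade A b"
    and "g = card (eigenvalues A)"
    and "\<not> pos_semidef A"
  shows "(\<exists>k. 1 \<le> k \<and> k \<le> g \<and> \<not> pos_def_upto k (minres_T A b)) \<and>
         (\<exists>k. 1 \<le> k \<and> k \<le> g \<and> minres_npc A b k)"
proof -
  have gr: "is_grade A b g" using is_grade_grade[OF assms(2)] assms(3) by simp
  then have g: "1 \<le> g" by (simp add: is_grade_def)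
  obtain u where u: "u \<in> krylov A b g" "u \<bullet> (A *v u) < 0"
    using negative_vector_in_krylov_grade[OF assms(1) gr assms(4,5)] .
  have not_pd: "\<not> pos_def_upto g (minres_T A b)"
  proof (rule not_pos_def_upto_compression)
    show "lanczos_v A b i \<bullet> lanczos_v A b j = (if i = j then 1 else 0)"
      if "i \<in> {1..g}" "j \<in> {1..g}" for i j
      using that g lanczos_orthonormal(2)[OF assms(1,2) gr, of "g - 1" i j] by simp
    show "u \<in> span (lanczos_v A b ` {1..g})"
      using u(1) krylov_subset_span_lanczos[OF assms(1,2) gr] by blast
  qed (use u minres_T_eq_compression[OF assms(1,2) gr] in auto)
  moreover have "\<exists>k. 1 \<le> k \<and> k \<le> g \<and> minres_npc A b k"
    using pos_def_upto_minres_T[OF g lanczos_orthonormal(1)[OF assms(1,2) gr]] not_pd by blast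
  ultimately show ?thesis using g by blast
qed

end
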